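(* Let $A$ be an $n\times n$ permutation matrix and let $X$ be a proper doubly stochastic solution of $AXA=XAX$, i.e. $X$ is a doubly stochastic $n\times n$ matrix which is not a permutation matrix and satisfies $AXA=XAX$. Then $X$ is a normal partial isometry.
   Context: A doubly stochastic matrix is a real square matrix with nonnegative entries, all of whose row sums and column sums equal $1$. Here $\mathbb R^n$ carries the standard inner product; a partial isometry is a matrix $X$ with $\|Xu\|=\|u\|$ for all $u$ in the orthogonal complement of its null space; normal means $XX^*=X^*X$. *)

theory Defs
  imports "HOL-Analysis.Analysis"
begin

definition doubly_stochastic :: "real^'n^'n \<Rightarrow> bool" where
  "doubly_stochastic X \<longleftrightarrow>
     (\<forall>i j. 0 \<le> X $ i $ j) \<and>
     (\<forall>i. (\<Sum>j\<in>UNIV. X $ i $ j) = 1) \<and>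
     (\<forall>j. (\<Sum>i\<in>UNIV. X $ i $ j) = 1)"

definition permutation_matrix :: "real^'n^'n \<Rightarrow> bool" where
  "permutation_matrix X \<longleftrightarrow>
     (\<exists>p. p permutes UNIV \<and> X = (\<chi> i j. if j = p i then 1 else 0))"

definition proper_doubly_stochastic :: "real^'n^'n \<Rightarrow> bool" where
  "proper_doubly_stochastic X \<longleftrightarrow> doubly_stochastic X \<and> \<not> permutation_matrix X"

definition null_space :: "real^'n^'m \<Rightarrow> (real^'n) set" where
  "null_space X = {v. X *v v = 0}"

definition partial_isometry :: "real^'n^'m \<Rightarrow> bool" where
  "partial_isometry X \<longleftrightarrow> (\<forall>u \<in> orthogonal_comp (null_space X). norm (X *v u) = norm u)"

text \<open>For a real matrix the adjoint is the transpose.\<close>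

definition normal_matrix :: "real^'n^'n \<Rightarrow> bool" where
  "normal_matrix X \<longleftrightarrow> X ** transpose X = transpose X ** X"

end

theory Submission
  imports Defs "HOL-Combinatorics.Cycles"
begin

text \<open>
  The relation \<open>A X A = X A X\<close> is a braid relation, so it lets powers of \<open>A\<close> be exchanged for
  powers of \<open>X\<close>: \<open>X\<^sup>n A X = A X A\<^sup>n\<close> and \<open>X A X\<^sup>n = A\<^sup>n X A\<close>. A permutation matrix has finite
  order, say \<open>A\<^sup>k = 1\<close> with \<open>k > 0\<close>; then \<open>M = X\<^sup>k\<close> satisfies \<open>M A X = A X\<close> and \<open>X A M = X A\<close>.
  These give \<open>A M = M A M = M A\<close>, hence \<open>A M X = M A X = A X\<close>, and cancelling \<open>A\<close> leaves
  \<open>X\<^sup>k\<^sup>+\<^sup>1 = X\<close> (lemma \<open>braid_power_fixes\<close>).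

  The rest uses only that a doubly stochastic matrix is a contraction of Euclidean space. A
  contraction preserves the norm of every vector \<open>y\<close> with \<open>X\<^sup>k y = y\<close>, so that
  \<open>X\<^sup>T X y = y\<close>. Since \<open>X\<^sup>k\<close> is idempotent and \<open>X = X X\<^sup>k\<close>, this
  yields \<open>X\<^sup>T X = X\<^sup>k\<close> (lemma \<open>gram_eq_power\<close>). The transpose satisfies the same
  hypotheses, so \<open>X X\<^sup>T = (X\<^sup>T)\<^sup>k = (X\<^sup>T X)\<^sup>T = X\<^sup>T X\<close>. Thus \<open>X\<close> is normal, and
  \<open>X\<^sup>T X\<close> is the orthogonal projection along the null space of \<open>X\<close>, which is what being a
  partial isometry means.
\<close>

text \<open>
  Powers are iterates of maps here, which avoids a separate notion of matrix power; for matrices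
  the maps are \<open>(*v) A\<close> and \<open>(*v) X\<close>.
\<close>

lemma braid_power_fixes:
  fixes a x :: "'a \<Rightarrow> 'a"
  assumes braid: "\<And>v. a (x (a v)) = x (a (x v))"
    and order: "a ^^ k = id" and "k > 0"
  shows "(x ^^ k) (x v) = x v"
proof -
  obtain j where k: "k = Suc j" using \<open>k > 0\<close> by (cases k) auto
  have "(x ^^ n) (a (x v)) = a (x ((a ^^ n) v))" for n v
    by (induction n) (simp_all add: braid)
  then have left: "(x ^^ k) (a (x v)) = a (x v)" for v
    using order by simp
  have "x (a ((x ^^ n) v)) = (a ^^ n) (x (a v))" for n v
    by (induction n) (simp_all flip: braid)
  then have right: "x (a ((x ^^ k) v)) = x (a v)" for v
    using order by simp
  have "(x ^^ k) (a ((x ^^ k) v)) = a ((x ^^ k) v)" for v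
    using left by (simp add: k)
  moreover have "(x ^^ k) (a ((x ^^ k) v)) = (x ^^ k) (a v)" for v
    using right[of v] by (simp add: k funpow_swap1)
  ultimately have commute: "a ((x ^^ k) v) = (x ^^ k) (a v)" for v
    by metis
  have "a ((x ^^ k) (x v)) = a (x v)"
    by (simp add: commute left)
  then have "(a ^^ k) ((x ^^ k) (x v)) = (a ^^ k) (x v)"
    by (simp add: k funpow_swap1)
  then show ?thesis using order by simp
qed

lemma permutation_matrix_mult_vec_finite_order:
  fixes A :: "real^'n^'n"
  assumes "permutation_matrix A"
  obtains k where "k > 0" "(*v) A ^^ k = id"
proof -
  obtain p where p: "p permutes (UNIV :: 'n set)"
    and A: "A = (\<chi> i j. if j = p i then 1 else 0)"
    using assms unfolding permutation_matrix_def by blast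
  have shift: "(A *v v) $ i = v $ p i" for v i
    by (simp add: A matrix_vector_mult_def if_distrib[of "\<lambda>c. c * _"] cong: if_cong)
  have iterate: "((*v) A ^^ n) v $ i = v $ (p ^^ n) i" for n v i
    by (induction n arbitrary: i) (simp_all add: shift flip: funpow_swap1)
  have "permutation p"
    using p by (auto simp: permutation_permutes)
  then obtain k where "k > 0" "p ^^ k = id"
    using permutation_is_nilpotent by blast
  with iterate have "(*v) A ^^ k = id"
    by (auto simp: fun_eq_iff vec_eq_iff)
  with \<open>k > 0\<close> show ?thesis by (rule that)
qed

text \<open>
  Each coordinate of \<open>X y\<close> is a mean of the coordinates of \<open>y\<close>, with weights from a row of \<open>X\<close>.
  Nonnegativity of the variance bounds its square by the mean of the squares, and summing over
  the rows uses that the columns have sum one.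
\<close>

lemma doubly_stochastic_contraction:
  fixes X :: "real^'n^'n"
  assumes "doubly_stochastic X"
  shows "norm (X *v y) \<le> norm y"
proof -
  have nonneg: "0 \<le> X $ i $ j" and row: "(\<Sum>j\<in>UNIV. X $ i $ j) = 1"
    and col: "(\<Sum>i\<in>UNIV. X $ i $ j) = 1" for i j
    using assms by (auto simp: doubly_stochastic_def)
  have jensen: "((X *v y) $ i)\<^sup>2 \<le> (\<Sum>j\<in>UNIV. X $ i $ j * (y $ j)\<^sup>2)" for i
  proof -
    define m where "m = (\<Sum>j\<in>UNIV. X $ i $ j * y $ j)"
    have "0 \<le> (\<Sum>j\<in>UNIV. X $ i $ j * (y $ j - m)\<^sup>2)"
      by (intro sum_nonneg mult_nonneg_nonneg nonneg) simp
    also have "\<dots> = (\<Sum>j\<in>UNIV. X $ i $ j * (y $ j)\<^sup>2 - 2 * m * (X $ i $ j * y $ j)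
                      + m\<^sup>2 * X $ i $ j)"
      by (intro sum.cong) (auto simp: power2_eq_square algebra_simps)
    also have "\<dots> = (\<Sum>j\<in>UNIV. X $ i $ j * (y $ j)\<^sup>2) - 2 * m * m + m\<^sup>2 * 1"
      by (simp only: sum.distrib sum_subtractf sum_distrib_left[symmetric] row m_def[symmetric])
    finally show ?thesis
      by (simp add: matrix_vector_mult_def m_def power2_eq_square)
  qed
  have "(norm (X *v y))\<^sup>2 = (\<Sum>i\<in>UNIV. ((X *v y) $ i)\<^sup>2)"
    unfolding power2_norm_eq_inner inner_vec_def by (simp add: power2_eq_square)
  also have "\<dots> \<le> (\<Sum>i\<in>UNIV. \<Sum>j\<in>UNIV. X $ i $ j * (y $ j)\<^sup>2)"
    by (intro sum_mono jensen)
  also have "\<dots> = (\<Sum>j\<in>UNIV. \<Sum>i\<in>UNIV. X $ i $ j * (y $ j)\<^sup>2)"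
    by (rule sum.swap)
  also have "\<dots> = (\<Sum>j\<in>UNIV. (y $ j)\<^sup>2)"
    by (simp add: sum_distrib_right[symmetric] col)
  also have "\<dots> = (norm y)\<^sup>2"
    unfolding power2_norm_eq_inner inner_vec_def by (simp add: power2_eq_square)
  finally show ?thesis by (simp add: power2_le_iff_abs_le)
qed

lemma inner_mult_vec_transpose:
  fixes X :: "real^'n^'m"
  shows "(X *v u) \<bullet> v = u \<bullet> (transpose X *v v)"
  by (metis dot_lmul_matrix inner_commute transpose_matrix_vector)

lemma inner_funpow_mult_vec_transpose:
  fixes X :: "real^'n^'n"
  shows "((*v) X ^^ n) u \<bullet> v = u \<bullet> ((*v) (transpose X) ^^ n) v"
  by (induction n arbitrary: v) (simp_all add: inner_mult_vec_transpose del: transpose_matrix_vector flip: funpow_swap1)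

lemma contraction_transpose:
  fixes X :: "real^'n^'m"
  assumes contr: "\<And>u. norm (X *v u) \<le> norm u"
  shows "norm (transpose X *v v) \<le> norm v"
proof -
  let ?w = "transpose X *v v"
  have "norm ?w * norm ?w = (X *v ?w) \<bullet> v"
    by (simp add: inner_mult_vec_transpose flip: power2_eq_square power2_norm_eq_inner)
  also have "\<dots> \<le> norm (X *v ?w) * norm v"
    by (rule norm_cauchy_schwarz)
  also have "\<dots> \<le> norm ?w * norm v"
    by (intro mult_right_mono contr) simp
  finally show ?thesis
    by (cases "norm ?w = 0") (auto simp: mult_le_cancel_left_pos)
qed

text \<open>
  The equality case of Cauchy-Schwarz: \<open>X\<^sup>T X y\<close> is no longer than \<open>y\<close>, and its inner product
  with \<open>y\<close> is \<open>\<parallel>X y\<parallel>\<^sup>2 = \<parallel>y\<parallel>\<^sup>2\<close>, which only \<open>y\<close> itself allows.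
\<close>

lemma contraction_isometric_at:
  fixes X :: "real^'n^'m"
  assumes contr: "\<And>u. norm (X *v u) \<le> norm u"
    and isometric: "norm (X *v y) = norm y"
  shows "transpose X *v (X *v y) = y"
proof -
  let ?w = "transpose X *v (X *v y)"
  have "norm ?w \<le> norm y"
    using contraction_transpose[OF contr, of "X *v y"] isometric by simp
  then have "?w \<bullet> ?w \<le> y \<bullet> y"
    by (simp add: norm_le)
  moreover have "?w \<bullet> y = y \<bullet> y"
    using isometric by (metis inner_commute inner_mult_vec_transpose power2_norm_eq_inner)
  ultimately have "(?w - y) \<bullet> (?w - y) \<le> 0"
    by (simp add: inner_diff inner_commute)
  then show ?thesis
    by (metis eq_iff_diff_eq_0 inner_eq_zero_iff inner_ge_zero order_antisym)
qed

text \<open>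
  Under these hypotheses a vector fixed by \<open>X\<^sup>k\<close> cannot lose norm under its first application of \<open>X\<close>, because later
  applications could not restore it. The vectors fixed by \<open>X\<^sup>k\<close> are exactly those of the form
  \<open>X\<^sup>k u\<close>.
\<close>

lemma gram_eq_power:
  fixes X :: "real^'n^'n"
  assumes contr: "\<And>u. norm (X *v u) \<le> norm u"
    and fixes_range: "\<And>u. ((*v) X ^^ k) (X *v u) = X *v u" and "k > 0"
  shows "transpose X *v (X *v u) = ((*v) X ^^ k) u"
proof -
  obtain j where k: "k = Suc j" using \<open>k > 0\<close> by (cases k) auto
  define y where "y = ((*v) X ^^ k) u"
  have "norm (((*v) X ^^ n) v) \<le> norm v" for n v
    by (induction n) (auto intro: order_trans[OF contr])
  then have "norm (((*v) X ^^ j) (X *v y)) \<le> norm (X *v y)" .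
  moreover have "((*v) X ^^ k) y = y"
    using fixes_range by (simp add: y_def k)
  ultimately have "norm y \<le> norm (X *v y)"
    by (simp add: k funpow_swap1)
  then have "transpose X *v (X *v y) = y"
    by (intro contraction_isometric_at contr order_antisym)
  moreover have "X *v y = X *v u"
    using fixes_range[of u] by (simp add: y_def funpow_swap1)
  ultimately show ?thesis by (simp add: y_def)
qed

lemma contraction_power_normal:
  fixes X :: "real^'n^'n"
  assumes contr: "\<And>u. norm (X *v u) \<le> norm u"
    and fixes_range: "\<And>u. ((*v) X ^^ k) (X *v u) = X *v u" and "k > 0"
  shows "normal_matrix X"
proof -
  let ?T = "transpose X"
  have fixes_range': "((*v) ?T ^^ k) (?T *v u) = ?T *v u" for u
  proof -
    have "v \<bullet> ((*v) ?T ^^ k) (?T *v u) = v \<bullet> (?T *v u)" for v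
      using fixes_range[of v]
      by (metis funpow_swap1 inner_funpow_mult_vec_transpose inner_mult_vec_transpose)
    then show ?thesis using vector_eq_ldot by blast
  qed
  have "X *v (?T *v u) = ((*v) ?T ^^ k) u" for u
    using gram_eq_power[of ?T, OF contraction_transpose[OF contr] fixes_range' \<open>k > 0\<close>] by simp
  then have "v \<bullet> (X *v (?T *v u)) = v \<bullet> (?T *v (X *v u))" for u v
    using gram_eq_power[OF contr fixes_range \<open>k > 0\<close>, of v]
    by (metis inner_funpow_mult_vec_transpose inner_mult_vec_transpose transpose_transpose)
  then have "X *v (?T *v u) = ?T *v (X *v u)" for u
    using vector_eq_ldot by blast
  then show ?thesis
    by (simp add: normal_matrix_def matrix_eq matrix_vector_mul_assoc[symmetric])
qed

text \<open>
  By \<open>X X\<^sup>k = X\<close>, the vector \<open>u - X\<^sup>k u\<close> lies in the null space; if \<open>u\<close> is orthogonal to it, then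
  \<open>\<parallel>u\<parallel>\<^sup>2 = u \<bullet> X\<^sup>k u = u \<bullet> X\<^sup>T X u = \<parallel>X u\<parallel>\<^sup>2\<close>.
\<close>

lemma contraction_power_partial_isometry:
  fixes X :: "real^'n^'n"
  assumes contr: "\<And>u. norm (X *v u) \<le> norm u"
    and fixes_range: "\<And>u. ((*v) X ^^ k) (X *v u) = X *v u" and "k > 0"
  shows "partial_isometry X"
  unfolding partial_isometry_def
proof
  fix u assume u: "u \<in> orthogonal_comp (null_space X)"
  let ?e = "((*v) X ^^ k) u"
  have "u - ?e \<in> null_space X"
    using fixes_range[of u]
    by (simp add: null_space_def matrix_vector_mult_diff_distrib funpow_swap1)
  then have "u \<bullet> (u - ?e) = 0"
    using u by (auto simp: orthogonal_comp_def orthogonal_def inner_commute)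
  then have "(X *v u) \<bullet> (X *v u) = u \<bullet> u"
    using gram_eq_power[OF contr fixes_range \<open>k > 0\<close>, of u]
    by (simp add: inner_mult_vec_transpose inner_diff_right)
  then show "norm (X *v u) = norm u"
    by (simp add: norm_eq)
qed

theorem lemma4p2:
  fixes A X :: "real^'n^'n"
  assumes "permutation_matrix A"
    and "proper_doubly_stochastic X"
    and "A ** X ** A = X ** A ** X"
  shows "normal_matrix X \<and> partial_isometry X"
proof -
  obtain k where k: "k > 0" "(*v) A ^^ k = id"
    using permutation_matrix_mult_vec_finite_order[OF assms(1)] .
  have "A *v (X *v (A *v v)) = X *v (A *v (X *v v))" for v
    using assms(3) by (simp add: matrix_vector_mul_assoc matrix_mul_assoc)
  then have "((*v) X ^^ k) (X *v u) = X *v u" for u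
    by (rule braid_power_fixes[OF _ k(2,1)])
  moreover have "norm (X *v u) \<le> norm u" for u
    using assms(2) by (simp add: proper_doubly_stochastic_def doubly_stochastic_contraction)
  ultimately show ?thesis
    using contraction_power_normal contraction_power_partial_isometry k(1) by blast
qed

end
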